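(* Let $n\ge 1$, let $\theta_1,\dots,\theta_n>0$ be pairwise distinct, and let $S_n\sim\mathrm{HypoXG}(\theta_1,\dots,\theta_n)$. Then, for all real $t<\min_{1\le i\le n}\theta_i$, the moment generating function $\Phi_{S_n}(t)=E[e^{tS_n}]$ satisfies $$\Phi_{S_n}(t)=\sum_{i=1}^{n}\sum_{k=1}^{3}R_{ik}\,\Phi_{Y_{ik}}(t),$$ where $\Phi_{Y_{ik}}(t)=E[e^{tY_{ik}}]=\frac{\theta_i^{4-k}}{(\theta_i-t)^{4-k}}$ is the moment generating function of $Y_{ik}\sim\mathrm{Erl}(4-k,\theta_i)$ and the $R_{ik}$ are the HypoXG coefficients associated with $(\theta_1,\dots,\theta_n)$.
   Context: XGamma distribution: for $\theta>0$, $X\sim \mathrm{XG}(\theta)$ means $X$ is a real random variable with density $\frac{\theta^2}{1+\theta}\left(1+\frac{\theta}{2}t^2\right)e^{-\theta t}$ for $t>0$, and $0$ otherwise. HypoXG: $S_n\sim\mathrm{HypoXG}(\theta_1,\dots,\theta_n)$ means $S_n=X_1+\cdots+X_n$ with $X_1,\dots,X_n$ independent and $X_j\sim\mathrm{XG}(\theta_j)$. Erlang distribution: for an integer $m\ge 1$ and $\theta>0$, $Y\sim\mathrm{Erl}(m,\theta)$ means $Y$ has density $\frac{(\theta t)^{m-1}\theta e^{-\theta t}}{(m-1)!}$ for $t\ge 0$ and $0$ for $t<0$. HypoXG coefficients: for pairwise distinct $\theta_1,\dots,\theta_n>0$, $1\le i\le n$, $1\le k\le 3$, $$R_{ik}=\frac{A_{ik}}{\theta_i^{4-k}}\prod_{l=1}^{n}\frac{\theta_l^{2}}{1+\theta_l},$$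 where $$A_{i1}=\theta_i\prod_{j\ne i}\frac{(\theta_j-\theta_i)^2+\theta_j}{(\theta_j-\theta_i)^3},\qquad A_{i2}=A_{i1}\sum_{j\neq i}\left(\frac{2(\theta_j-\theta_i)}{(\theta_j-\theta_i)^2+\theta_j}-\frac{3}{\theta_j-\theta_i}\right),$$ $$A_{i3}=\frac{A_{i1}}{2}\left(\sum_{j\ne i}\left(\frac{2(\theta_j-\theta_i)}{(\theta_j-\theta_i)^2+\theta_j}-\frac{3}{\theta_j-\theta_i}\right)\right)^{2}+\frac{A_{i1}}{2}\left(\frac{2}{\theta_i}+\sum_{j\ne i}\left(-2\,\frac{(\theta_j-\theta_i)^2-\theta_j}{\left((\theta_j-\theta_i)^2+\theta_j\right)^2}+\frac{3}{(\theta_j-\theta_i)^2}\right)\right),$$ products and sums being over $j\in\{1,\dots,n\}\setminus\{i\}$ (empty product $=1$, empty sum $=0$). *)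

theory Defs
  imports "HOL-Probability.Probability"
begin

definition xgamma_density :: "real \<Rightarrow> real \<Rightarrow> real" where
  "xgamma_density \<theta> t =
     (if t > 0 then \<theta>\<^sup>2 / (1 + \<theta>) * (1 + \<theta> / 2 * t\<^sup>2) * exp (- \<theta> * t) else 0)"

definition hypoXG :: "'a measure \<Rightarrow> ('a \<Rightarrow> real) \<Rightarrow> nat \<Rightarrow> (nat \<Rightarrow> real) \<Rightarrow> bool" where
  "hypoXG M S n \<theta> \<longleftrightarrow>
     (\<exists>X. prob_space.indep_vars M (\<lambda>_. borel) X {1..n} \<and>
          (\<forall>j\<in>{1..n}. distributed M lborel (X j) (xgamma_density (\<theta> j))) \<and>
          (\<forall>\<omega>\<in>space M. S \<omega> = (\<Sum>j=1..n. X j \<omega>)))"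

text \<open>The Erlang law with shape m and rate \<open>\<theta>\<close>. The library's \<^const>\<open>erlang_density\<close> takes as first
  argument the shape minus one, so this is meaningful only for \<open>m \<ge> 1\<close>.\<close>

definition erlang_distributed :: "'a measure \<Rightarrow> ('a \<Rightarrow> real) \<Rightarrow> nat \<Rightarrow> real \<Rightarrow> bool" where
  "erlang_distributed M Y m \<theta> \<longleftrightarrow> distributed M lborel Y (erlang_density (m - 1) \<theta>)"

text \<open>A Bochner integral, hence 0 where the exponential moment is infinite; finiteness has to be
  stated separately.\<close>

definition mgf :: "'a measure \<Rightarrow> ('a \<Rightarrow> real) \<Rightarrow> real \<Rightarrow> real" where
  "mgf M X t = (\<integral>\<omega>. exp (t * X \<omega>) \<partial>M)"

definition hypoXG_A1 :: "nat \<Rightarrow> (nat \<Rightarrow> real) \<Rightarrow> nat \<Rightarrow> real" where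
  "hypoXG_A1 n \<theta> i =
     \<theta> i * (\<Prod>j\<in>{1..n} - {i}. ((\<theta> j - \<theta> i)\<^sup>2 + \<theta> j) / (\<theta> j - \<theta> i) ^ 3)"

definition hypoXG_A2 :: "nat \<Rightarrow> (nat \<Rightarrow> real) \<Rightarrow> nat \<Rightarrow> real" where
  "hypoXG_A2 n \<theta> i = hypoXG_A1 n \<theta> i *
     (\<Sum>j\<in>{1..n} - {i}. 2 * (\<theta> j - \<theta> i) / ((\<theta> j - \<theta> i)\<^sup>2 + \<theta> j) - 3 / (\<theta> j - \<theta> i))"

definition hypoXG_A3 :: "nat \<Rightarrow> (nat \<Rightarrow> real) \<Rightarrow> nat \<Rightarrow> real" where
  "hypoXG_A3 n \<theta> i =
     hypoXG_A1 n \<theta> i / 2 *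
       (\<Sum>j\<in>{1..n} - {i}. 2 * (\<theta> j - \<theta> i) / ((\<theta> j - \<theta> i)\<^sup>2 + \<theta> j) - 3 / (\<theta> j - \<theta> i))\<^sup>2
     + hypoXG_A1 n \<theta> i / 2 *
       (2 / \<theta> i +
        (\<Sum>j\<in>{1..n} - {i}. - 2 * (((\<theta> j - \<theta> i)\<^sup>2 - \<theta> j) / ((\<theta> j - \<theta> i)\<^sup>2 + \<theta> j)\<^sup>2)
                          + 3 / (\<theta> j - \<theta> i)\<^sup>2))"

text \<open>Only \<open>k = 1, 2, 3\<close> are meaningful.\<close>

definition hypoXG_A :: "nat \<Rightarrow> (nat \<Rightarrow> real) \<Rightarrow> nat \<Rightarrow> nat \<Rightarrow> real" where
  "hypoXG_A n \<theta> i k =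
     (if k = 1 then hypoXG_A1 n \<theta> i
      else if k = 2 then hypoXG_A2 n \<theta> i
      else hypoXG_A3 n \<theta> i)"

definition hypoXG_R :: "nat \<Rightarrow> (nat \<Rightarrow> real) \<Rightarrow> nat \<Rightarrow> nat \<Rightarrow> real" where
  "hypoXG_R n \<theta> i k =
     hypoXG_A n \<theta> i k / \<theta> i ^ (4 - k) * (\<Prod>l=1..n. (\<theta> l)\<^sup>2 / (1 + \<theta> l))"

end

theory Submission
  imports Defs "HOL-Number_Theory.Cong"
begin

text \<open>The moment generating function factorises over the independent summands, and each factor
  \<open>\<theta>\<^sub>j\<^sup>2/(1+\<theta>\<^sub>j) \<cdot> ((\<theta>\<^sub>j-t)\<^sup>2+\<theta>\<^sub>j)/(\<theta>\<^sub>j-t)\<^sup>3\<close> has a triple pole at \<open>\<theta>\<^sub>j\<close>. The coefficients \<open>A\<^sub>i\<^sub>k\<close> are the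
  Taylor coefficients, in powers of \<open>\<theta>\<^sub>i-t\<close>, of the product with its pole at \<open>\<theta>\<^sub>i\<close> cleared. After
  multiplication by the common denominator, both sides of the partial fraction expansion become
  polynomials of degree below \<open>3n\<close> that agree to third order at each of the \<open>n\<close> points \<open>\<theta>\<^sub>i\<close>, so
  they coincide.\<close>

section \<open>Moment generating functions\<close>

text \<open>Multiplying by \<open>exp (t * x)\<close> only lowers the rate from \<open>l\<close> to
  \<open>l - t\<close>; the factor corrects the normalising constant \<open>l ^ Suc k\<close>.
  Exponential moments thus reduce to the total mass of another Erlang density.\<close>

lemma erlang_density_exponential_tilt:
  assumes "l > 0" "t < l"
  shows "erlang_density k l x * exp (t * x) = (l / (l - t)) ^ Suc k * erlang_density k (l - t) x"
proof -
  have e: "exp (t * x) * exp (- (l * x)) = exp (x * (t - l))"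
    by (subst exp_add[symmetric]) (simp add: algebra_simps)
  show ?thesis using assms by (simp add: erlang_density_def power_divide mult_ac e)
qed

lemma has_bochner_integral_erlang_density:
  assumes "0 < l"
  shows "has_bochner_integral lborel (erlang_density k l) 1"
proof (rule has_bochner_integral_nn_integral)
  show "(\<integral>\<^sup>+ x. ennreal (erlang_density k l x) \<partial>lborel) = ennreal 1"
    using nn_integral_erlang_ith_moment[OF assms, of k 0] by simp
qed (use assms in auto)

lemma has_bochner_integral_erlang_mgf:
  assumes "l > 0" "t < l"
  shows "has_bochner_integral lborel (\<lambda>x. erlang_density k l x * exp (t * x)) ((l / (l - t)) ^ Suc k)"
  using has_bochner_integral_mult_right[OF has_bochner_integral_erlang_density[of "l - t" k],
      of "(l / (l - t)) ^ Suc k"] assms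
  by (simp add: erlang_density_exponential_tilt)

section \<open>XGamma laws as mixtures of Erlang laws\<close>

lemma xgamma_density_nonneg: "\<theta> > 0 \<Longrightarrow> 0 \<le> xgamma_density \<theta> x"
  by (simp add: xgamma_density_def)

lemma xgamma_density_measurable [measurable]: "xgamma_density \<theta> \<in> borel_measurable borel"
  by (simp add: xgamma_density_def[abs_def])

text \<open>The two summands of \<open>1 + \<theta> / 2 * x\<^sup>2\<close> yield an exponential and
  a shape-three Erlang density. At \<open>x = 0\<close> the sides differ, since the exponential
  density is positive there.\<close>

lemma xgamma_density_eq_erlang_mixture:
  assumes "\<theta> > 0" "x \<noteq> 0"
  shows "xgamma_density \<theta> x = \<theta> / (1 + \<theta>) * erlang_density 0 \<theta> x + 1 / (1 + \<theta>) * erlang_density 2 \<theta> x"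
proof -
  have "1 + \<theta> \<noteq> 0" using assms by simp
  then show ?thesis using assms(2)
    by (simp add: xgamma_density_def erlang_density_def divide_simps)
      (simp add: power2_eq_square power3_eq_cube algebra_simps numeral_eq_Suc)
qed

lemma has_bochner_integral_xgamma_mgf:
  assumes "\<theta> > 0" "t < \<theta>"
  shows "has_bochner_integral lborel (\<lambda>x. xgamma_density \<theta> x * exp (t * x))
           (\<theta>\<^sup>2 / (1 + \<theta>) * (((\<theta> - t)\<^sup>2 + \<theta>) / (\<theta> - t) ^ 3))"
proof -
  let ?f = "\<lambda>x. \<theta> / (1 + \<theta>) * (erlang_density 0 \<theta> x * exp (t * x))
    + 1 / (1 + \<theta>) * (erlang_density 2 \<theta> x * exp (t * x))"
  have "has_bochner_integral lborel ?f
      (\<theta> / (1 + \<theta>) * (\<theta> / (\<theta> - t)) ^ Suc 0 + 1 / (1 + \<theta>) * (\<theta> / (\<theta> - t)) ^ Suc 2)"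
    by (intro has_bochner_integral_add has_bochner_integral_mult_right
        has_bochner_integral_erlang_mgf assms)
  also have "\<theta> / (1 + \<theta>) * (\<theta> / (\<theta> - t)) ^ Suc 0 + 1 / (1 + \<theta>) * (\<theta> / (\<theta> - t)) ^ Suc 2
      = \<theta>\<^sup>2 / (1 + \<theta>) * (((\<theta> - t)\<^sup>2 + \<theta>) / (\<theta> - t) ^ 3)"
  proof -
    define u where "u = \<theta> - t"
    have "u \<noteq> 0" "1 + \<theta> \<noteq> 0" using assms by (auto simp: u_def)
    then show ?thesis
      unfolding u_def[symmetric]
      by (simp add: divide_simps) (simp add: power2_eq_square power3_eq_cube algebra_simps)
  qed
  finally have f: "has_bochner_integral lborel ?f
      (\<theta>\<^sup>2 / (1 + \<theta>) * (((\<theta> - t)\<^sup>2 + \<theta>) / (\<theta> - t) ^ 3))" .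
  \<comment> \<open>The mixture identity fails only on the null set \<open>{0}\<close>.\<close>
  have "AE x in lborel. ?f x = xgamma_density \<theta> x * exp (t * x)"
    using AE_lborel_singleton[of 0]
    by eventually_elim (simp add: xgamma_density_eq_erlang_mixture[OF assms(1)] algebra_simps)
  then show ?thesis
    by (intro has_bochner_integralI_AE[OF f]) simp_all
qed

text \<open>Integrability accompanies the value because \<open>mgf\<close> is 0 by default on a
  divergent integral.\<close>

lemma distributed_mgf:
  assumes "distributed M lborel X f" "\<And>x. 0 \<le> f x"
    and "has_bochner_integral lborel (\<lambda>x. f x * exp (t * x)) c"
  shows "integrable M (\<lambda>\<omega>. exp (t * X \<omega>))" "mgf M X t = c"
  using distributed_integrable[OF assms(1), of "\<lambda>x. exp (t * x)"]
    distributed_integral[OF assms(1), of "\<lambda>x. exp (t * x)"] assms(2,3)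
  by (auto simp: mgf_def has_bochner_integral_iff)

lemma hypoXG_mgf:
  assumes "prob_space M" "hypoXG M S n \<theta>"
    and pos: "\<And>i. i \<in> {1..n} \<Longrightarrow> \<theta> i > 0" and less: "\<And>i. i \<in> {1..n} \<Longrightarrow> t < \<theta> i"
  shows "integrable M (\<lambda>\<omega>. exp (t * S \<omega>))"
    and "mgf M S t = (\<Prod>j=1..n. (\<theta> j)\<^sup>2 / (1 + \<theta> j) * (((\<theta> j - t)\<^sup>2 + \<theta> j) / (\<theta> j - t) ^ 3))"
proof -
  interpret prob_space M by fact
  obtain X where X: "indep_vars (\<lambda>_. borel) X {1..n}"
    "\<And>j. j \<in> {1..n} \<Longrightarrow> distributed M lborel (X j) (xgamma_density (\<theta> j))"
    "\<And>\<omega>. \<omega> \<in> space M \<Longrightarrow> S \<omega> = (\<Sum>j=1..n. X j \<omega>)"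
    using assms(2) unfolding hypoXG_def by blast
  note single = distributed_mgf[OF X(2) xgamma_density_nonneg has_bochner_integral_xgamma_mgf]
  have indep: "indep_vars (\<lambda>_. borel) (\<lambda>j \<omega>. exp (t * X j \<omega>)) {1..n}"
    by (rule indep_vars_compose2[OF X(1)]) simp
  have S: "exp (t * S \<omega>) = (\<Prod>j=1..n. exp (t * X j \<omega>))" if "\<omega> \<in> space M" for \<omega>
    using X(3)[OF that] by (simp add: sum_distrib_left exp_sum)
  have "integrable M (\<lambda>\<omega>. \<Prod>j=1..n. exp (t * X j \<omega>))"
    by (rule indep_vars_integrable[OF _ indep]) (use single(1) pos less in auto)
  then show "integrable M (\<lambda>\<omega>. exp (t * S \<omega>))"
    by (subst Bochner_Integration.integrable_cong[OF refl S])
  have "mgf M S t = (\<integral>\<omega>. (\<Prod>j=1..n. exp (t * X j \<omega>)) \<partial>M)"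
    unfolding mgf_def by (rule Bochner_Integration.integral_cong[OF refl S])
  also have "\<dots> = (\<Prod>j=1..n. mgf M (X j) t)"
    unfolding mgf_def
    by (rule indep_vars_lebesgue_integral[OF _ indep]) (use single(1) pos less in auto)
  also have "\<dots> = (\<Prod>j=1..n. (\<theta> j)\<^sup>2 / (1 + \<theta> j) * (((\<theta> j - t)\<^sup>2 + \<theta> j) / (\<theta> j - t) ^ 3))"
    by (intro prod.cong refl single(2)) (use pos less in auto)
  finally show "mgf M S t = (\<Prod>j=1..n. (\<theta> j)\<^sup>2 / (1 + \<theta> j) * (((\<theta> j - t)\<^sup>2 + \<theta> j) / (\<theta> j - t) ^ 3))" .
qed

section \<open>Partial fractions\<close>

text \<open>The second-order Taylor polynomial with value \<open>c\<close>, logarithmic derivative \<open>l\<close> and second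
  logarithmic derivative \<open>m\<close> at \<open>0\<close>, evaluated at \<open>s\<close>. In this parametrisation a product has
  value \<open>\<Prod>c\<close> and logarithmic derivatives \<open>\<Sum>l\<close>, \<open>\<Sum>m\<close>.\<close>

definition log_taylor2 :: "real \<Rightarrow> real \<Rightarrow> real \<Rightarrow> real poly \<Rightarrow> real poly" where
  "log_taylor2 c l m s = [:c:] + [:c * l:] * s + [:c * (l\<^sup>2 + m) / 2:] * s\<^sup>2"

text \<open>Logarithmic derivatives add under multiplication. With \<open>b\<close> and
  \<open>b'\<close> the quadratic coefficients relative to the values \<open>c\<close> and
  \<open>c'\<close>, the product has relative quadratic coefficient \<open>b + b' + l * l'\<close>,
  which is what adding \<open>l\<close> and \<open>m\<close> produces. The cofactor of
  \<open>s ^ 3\<close> collects orders 3 and 4.\<close>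

lemma log_taylor2_mult_cong:
  "[log_taylor2 c l m s * log_taylor2 c' l' m' s = log_taylor2 (c * c') (l + l') (m + m') s] (mod s ^ 3)"
proof -
  define b where "b = (l\<^sup>2 + m) / 2"
  define b' where "b' = (l'\<^sup>2 + m') / 2"
  have eqs: "c * (l\<^sup>2 + m) / 2 = c * b" "c' * (l'\<^sup>2 + m') / 2 = c' * b'"
    "c * c' * ((l + l')\<^sup>2 + (m + m')) / 2 = c * c' * (b + b' + l * l')"
    by (simp_all add: b_def b'_def power2_eq_square field_simps)
  have "log_taylor2 c l m s * log_taylor2 c' l' m' s - log_taylor2 (c * c') (l + l') (m + m') s
      = s ^ 3 * ([:c * c' * (l * b' + l' * b):] + [:c * c' * b * b':] * s)"
    \<comment> \<open>Real polynomials that agree as functions are equal, so real arithmetic in the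
      value of \<open>s\<close> suffices.\<close>
    unfolding log_taylor2_def eqs poly_eq_poly_eq_iff[symmetric]
    by (rule ext) (simp add: algebra_simps power2_eq_square power3_eq_cube)
  then show ?thesis by (simp add: cong_iff_dvd_diff)
qed

lemma log_taylor2_prod_cong:
  assumes "finite J"
  shows "[(\<Prod>j\<in>J. log_taylor2 (c j) (l j) (m j) s)
    = log_taylor2 (\<Prod>j\<in>J. c j) (\<Sum>j\<in>J. l j) (\<Sum>j\<in>J. m j) s] (mod s ^ 3)"
  using assms
proof (induction J)
  case empty
  then show ?case by (simp add: log_taylor2_def one_pCons)
next
  case (insert j J)
  have "[log_taylor2 (c j) (l j) (m j) s * (\<Prod>j\<in>J. log_taylor2 (c j) (l j) (m j) s)
      = log_taylor2 (c j) (l j) (m j) s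
        * log_taylor2 (\<Prod>j\<in>J. c j) (\<Sum>j\<in>J. l j) (\<Sum>j\<in>J. m j) s] (mod s ^ 3)"
    by (intro cong_mult cong_refl insert.IH)
  from cong_trans[OF this log_taylor2_mult_cong] show ?case
    using insert.hyps by simp
qed

text \<open>Here \<open>c\<close>, \<open>l\<close>, \<open>m\<close> are the value at
  \<open>s = 0\<close> and the first two derivatives there of the logarithm
  \<open>ln ((d + s)\<^sup>2 + a) - 3 * ln (d + s)\<close>, taken formally. Clearing the cube turns
  the Taylor expansion into a polynomial congruence.\<close>

lemma quadratic_over_cube_taylor:
  fixes d a :: real and s :: "real poly"
  assumes d: "d \<noteq> 0" and q: "d\<^sup>2 + a \<noteq> 0"
  defines "c \<equiv> (d\<^sup>2 + a) / d ^ 3" and "l \<equiv> 2 * d / (d\<^sup>2 + a) - 3 / d"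
    and "m \<equiv> - 2 * ((d\<^sup>2 - a) / (d\<^sup>2 + a)\<^sup>2) + 3 / d\<^sup>2"
  shows "[([:d:] + s)\<^sup>2 + [:a:] = ([:d:] + s) ^ 3 * log_taylor2 c l m s] (mod s ^ 3)"
proof -
  \<comment> \<open>Named reciprocals with \<open>d * e = 1\<close> and \<open>r * f = 1\<close>
    make the identities below polynomial, as \<open>algebra\<close> requires.\<close>
  define e r f where "e = 1 / d" and "r = d\<^sup>2 + a" and "f = 1 / r"
  have de: "d * e = 1" and rf: "r * f = 1" and a: "a = r - d\<^sup>2"
    using d q by (simp_all add: e_def f_def r_def)
  \<comment> \<open>These are the Taylor coefficients of
    \<open>1 / (d + s) + a / (d + s) ^ 3\<close>, the same quotient split into two powers.\<close>
  define \<alpha> \<beta> \<gamma> where "\<alpha> = e + a * e ^ 3" and "\<beta> = - (e\<^sup>2) - 3 * a * e ^ 4" and "\<gamma> = e ^ 3 + 6 * a * e ^ 5"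
  have clm: "c = r * e ^ 3" "l = 2 * d * f - 3 * e" "m = - 2 * (d\<^sup>2 - a) * f\<^sup>2 + 3 * e\<^sup>2"
    by (simp_all add: c_def l_def m_def e_def f_def power_divide flip: r_def)
  have c: "c = \<alpha>"
    unfolding clm \<alpha>_def a using de by algebra
  have cl: "c * l = \<beta>"
    unfolding clm \<beta>_def a using de rf by algebra
  have "c * (l\<^sup>2 + m) = 2 * \<gamma>"
    unfolding clm \<gamma>_def a using de rf by algebra
  then have cm: "c * (l\<^sup>2 + m) / 2 = \<gamma>" by simp
  \<comment> \<open>\<open>k0\<close>, \<open>k1\<close>, \<open>k2\<close> compare the coefficients
    of orders 0, 1, 2 in the claimed congruence; orders 3 to 5 form the cofactor below.\<close>
  have k0: "d ^ 3 * \<alpha> = d\<^sup>2 + a"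
    unfolding \<alpha>_def using de by algebra
  have k1: "3 * d\<^sup>2 * \<alpha> + d ^ 3 * \<beta> = 2 * d"
    unfolding \<alpha>_def \<beta>_def using de by algebra
  have k2: "3 * d * \<alpha> + 3 * d\<^sup>2 * \<beta> + d ^ 3 * \<gamma> = 1"
    unfolding \<alpha>_def \<beta>_def \<gamma>_def using de by algebra
  have "([:d:] + s)\<^sup>2 + [:a:] - ([:d:] + s) ^ 3 * log_taylor2 c l m s
      = s ^ 3 * - ([:\<alpha> + 3 * d * \<beta> + 3 * d\<^sup>2 * \<gamma>:] + [:\<beta> + 3 * d * \<gamma>:] * s + [:\<gamma>:] * s\<^sup>2)"
    unfolding log_taylor2_def cl cm unfolding c poly_eq_poly_eq_iff[symmetric]
  proof (rule ext)
    fix x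
    define y where "y = poly s x"
    have "(d + y)\<^sup>2 + a - (d + y) ^ 3 * (\<alpha> + \<beta> * y + \<gamma> * y\<^sup>2)
      = y ^ 3 * - ((\<alpha> + 3 * d * \<beta> + 3 * d\<^sup>2 * \<gamma>) + (\<beta> + 3 * d * \<gamma>) * y + \<gamma> * y\<^sup>2)"
      using k0 k1 k2 by algebra
    then show "poly (([:d:] + s)\<^sup>2 + [:a:] - ([:d:] + s) ^ 3 * ([:\<alpha>:] + [:\<beta>:] * s + [:\<gamma>:] * s\<^sup>2)) x
      = poly (s ^ 3 * - ([:\<alpha> + 3 * d * \<beta> + 3 * d\<^sup>2 * \<gamma>:] + [:\<beta> + 3 * d * \<gamma>:] * s + [:\<gamma>:] * s\<^sup>2)) x"
      by (simp add: y_def)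
  qed
  then show ?thesis by (simp add: cong_iff_dvd_diff)
qed

section \<open>From local congruences to a polynomial identity\<close>

text \<open>A nonzero \<open>p\<close> would have at least \<open>3 * card R\<close> roots counted
  with multiplicity, more than its degree allows.\<close>

lemma poly_eq_0_if_triple_roots:
  fixes p :: "'a :: idom poly"
  assumes "finite R" "\<And>r. r \<in> R \<Longrightarrow> [:-r, 1:] ^ 3 dvd p" "degree p < 3 * card R"
  shows "p = 0"
proof (rule ccontr)
  assume p: "p \<noteq> 0"
  have ord: "3 \<le> order r p" if "r \<in> R" for r
    using assms(2)[OF that] p by (simp add: order_divides)
  have "3 * card R \<le> (\<Sum>r\<in>R. order r p)"
    using sum_mono[of R "\<lambda>_. 3" "\<lambda>r. order r p"] ord by (simp add: mult.commute)
  also have "\<dots> \<le> (\<Sum>r | poly p r = 0. order r p)"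
  proof (rule sum_mono2)
    show "R \<subseteq> {r. poly p r = 0}" using ord by (fastforce simp: order_root)
  qed (simp_all add: poly_roots_finite p)
  also have "\<dots> \<le> degree p" by (rule sum_order_le_degree[OF p])
  finally show False using assms(3) by simp
qed

text \<open>The polynomial \<open>[:\<theta> i, -1:]\<close> is \<open>\<theta> i - X\<close>. This
  is the numerator of the three terms with pole at \<open>\<theta> i\<close>, put over the common
  denominator \<open>(\<theta> i - X) ^ 3\<close>.\<close>

definition hypoXG_numerator :: "nat \<Rightarrow> (nat \<Rightarrow> real) \<Rightarrow> nat \<Rightarrow> real poly" where
  "hypoXG_numerator n \<theta> i = [:hypoXG_A1 n \<theta> i:] + [:hypoXG_A2 n \<theta> i:] * [:\<theta> i, -1:]
     + [:hypoXG_A3 n \<theta> i:] * [:\<theta> i, -1:]\<^sup>2"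

text \<open>With \<open>s = \<theta> i - X\<close>, each factor \<open>j\<close> other than
  \<open>i\<close> is expanded at \<open>d j = \<theta> j - \<theta> i\<close>, and the expansions
  multiply to \<open>T\<close>. The factor at \<open>i\<close> is
  \<open>s\<^sup>2 + [:\<theta> i:]\<close>; its product with \<open>T\<close>, cut off below order
  3, is the numerator.\<close>

lemma hypoXG_numerator_cong:
  assumes pos: "\<And>i. i \<in> {1..n} \<Longrightarrow> \<theta> i > 0" and inj: "inj_on \<theta> {1..n}" and i: "i \<in> {1..n}"
  shows "[(\<Prod>j\<in>{1..n}. [:\<theta> j, -1:]\<^sup>2 + [:\<theta> j:])
    = hypoXG_numerator n \<theta> i * (\<Prod>j\<in>{1..n}-{i}. [:\<theta> j, -1:] ^ 3)] (mod [:\<theta> i, -1:] ^ 3)"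
proof -
  define s where "s = [:\<theta> i, -1:]"
  define J where "J = {1..n} - {i}"
  define d where "d j = \<theta> j - \<theta> i" for j
  define c l m where "c j = ((d j)\<^sup>2 + \<theta> j) / d j ^ 3" and "l j = 2 * d j / ((d j)\<^sup>2 + \<theta> j) - 3 / d j"
    and "m j = - 2 * (((d j)\<^sup>2 - \<theta> j) / ((d j)\<^sup>2 + \<theta> j)\<^sup>2) + 3 / (d j)\<^sup>2" for j
  define C L K where "C = (\<Prod>j\<in>J. c j)" and "L = (\<Sum>j\<in>J. l j)" and "K = (\<Sum>j\<in>J. m j)"
  define T where "T = log_taylor2 C L K s"
  have \<theta>i: "\<theta> i > 0" using pos i by simp
  \<comment> \<open>The term \<open>2 / \<theta> i\<close> in \<open>hypoXG_A3\<close> becomes the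
    summand \<open>C\<close>, which is what \<open>s\<^sup>2\<close> times the constant term of
    \<open>T\<close> contributes.\<close>
  have A: "hypoXG_A1 n \<theta> i = \<theta> i * C" "hypoXG_A2 n \<theta> i = \<theta> i * C * L"
    "hypoXG_A3 n \<theta> i = \<theta> i * C * (L\<^sup>2 + K) / 2 + C"
    using \<theta>i unfolding hypoXG_A1_def hypoXG_A2_def hypoXG_A3_def C_def L_def K_def c_def l_def m_def
      d_def J_def
    by (simp_all add: field_simps)
  have numerator: "[(s\<^sup>2 + [:\<theta> i:]) * T = hypoXG_numerator n \<theta> i] (mod s ^ 3)"
  proof -
    have "(s\<^sup>2 + [:\<theta> i:]) * T - hypoXG_numerator n \<theta> i
        = s ^ 3 * ([:C * L:] + [:C * (L\<^sup>2 + K) / 2:] * s)"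
      unfolding hypoXG_numerator_def A T_def log_taylor2_def s_def[symmetric]
        poly_eq_poly_eq_iff[symmetric]
    proof (rule ext)
      fix x
      define y Z where "y = poly s x" and "Z = C * (L\<^sup>2 + K) / 2"
      have Z: "\<theta> i * C * (L\<^sup>2 + K) / 2 = \<theta> i * Z" by (simp add: Z_def)
      have "(y\<^sup>2 + \<theta> i) * (C + C * L * y + Z * y\<^sup>2)
          - (\<theta> i * C + \<theta> i * C * L * y + (\<theta> i * Z + C) * y\<^sup>2)
        = y ^ 3 * (C * L + Z * y)"
        by algebra
      then show "poly ((s\<^sup>2 + [:\<theta> i:]) * ([:C:] + [:C * L:] * s + [:C * (L\<^sup>2 + K) / 2:] * s\<^sup>2)
          - ([:\<theta> i * C:] + [:\<theta> i * C * L:] * s + [:\<theta> i * C * (L\<^sup>2 + K) / 2 + C:] * s\<^sup>2)) x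
        = poly (s ^ 3 * ([:C * L:] + [:C * (L\<^sup>2 + K) / 2:] * s)) x"
        unfolding Z Z_def[symmetric] by (simp add: y_def)
    qed
    then show ?thesis by (simp add: cong_iff_dvd_diff)
  qed
  have "[(\<Prod>j\<in>J. [:\<theta> j, -1:]\<^sup>2 + [:\<theta> j:])
      = (\<Prod>j\<in>J. [:\<theta> j, -1:] ^ 3 * log_taylor2 (c j) (l j) (m j) s)] (mod s ^ 3)"
  proof (rule cong_prod)
    fix j assume j: "j \<in> J"
    then have d: "d j \<noteq> 0" using inj_onD[OF inj _ _ i, of j] unfolding J_def d_def by fastforce
    have q: "(d j)\<^sup>2 + \<theta> j \<noteq> 0"
      using pos[of j] j by (simp add: J_def add_nonneg_pos less_imp_neq[THEN not_sym])
    have shift: "[:\<theta> j, -1:] = [:d j:] + s" by (simp add: s_def d_def)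
    show "[[:\<theta> j, -1:]\<^sup>2 + [:\<theta> j:]
        = [:\<theta> j, -1:] ^ 3 * log_taylor2 (c j) (l j) (m j) s] (mod s ^ 3)"
      unfolding shift c_def l_def m_def by (rule quadratic_over_cube_taylor[OF d q])
  qed
  also have "[(\<Prod>j\<in>J. [:\<theta> j, -1:] ^ 3 * log_taylor2 (c j) (l j) (m j) s)
      = (\<Prod>j\<in>J. [:\<theta> j, -1:] ^ 3) * T] (mod s ^ 3)"
    unfolding prod.distrib T_def C_def L_def K_def
    by (intro cong_mult cong_refl log_taylor2_prod_cong) (simp add: J_def)
  finally have "[(s\<^sup>2 + [:\<theta> i:]) * (\<Prod>j\<in>J. [:\<theta> j, -1:]\<^sup>2 + [:\<theta> j:])
      = (s\<^sup>2 + [:\<theta> i:]) * ((\<Prod>j\<in>J. [:\<theta> j, -1:] ^ 3) * T)] (mod s ^ 3)"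
    by (intro cong_mult cong_refl)
  also have "(s\<^sup>2 + [:\<theta> i:]) * ((\<Prod>j\<in>J. [:\<theta> j, -1:] ^ 3) * T)
      = (s\<^sup>2 + [:\<theta> i:]) * T * (\<Prod>j\<in>J. [:\<theta> j, -1:] ^ 3)"
    by (simp only: ac_simps)
  also have "[\<dots> = hypoXG_numerator n \<theta> i * (\<Prod>j\<in>J. [:\<theta> j, -1:] ^ 3)] (mod s ^ 3)"
    by (intro cong_mult cong_refl numerator)
  also have "(s\<^sup>2 + [:\<theta> i:]) * (\<Prod>j\<in>J. [:\<theta> j, -1:]\<^sup>2 + [:\<theta> j:])
      = (\<Prod>j\<in>{1..n}. [:\<theta> j, -1:]\<^sup>2 + [:\<theta> j:])"
    unfolding s_def J_def by (subst prod.remove[OF _ i]) simp_all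
  finally show ?thesis by (simp only: s_def J_def)
qed

lemma hypoXG_numerator_identity:
  assumes "n \<ge> 1" and pos: "\<And>i. i \<in> {1..n} \<Longrightarrow> \<theta> i > 0" and inj: "inj_on \<theta> {1..n}"
  shows "(\<Prod>j\<in>{1..n}. [:\<theta> j, -1:]\<^sup>2 + [:\<theta> j:])
    = (\<Sum>i\<in>{1..n}. hypoXG_numerator n \<theta> i * (\<Prod>j\<in>{1..n}-{i}. [:\<theta> j, -1:] ^ 3))"
    (is "?P = (\<Sum>i\<in>_. ?F i)")
proof -
  have "?P - (\<Sum>i\<in>{1..n}. ?F i) = 0"
  proof (rule poly_eq_0_if_triple_roots)
    show "finite (\<theta> ` {1..n})" by simp
    have "degree ?P \<le> (\<Sum>j\<in>{1..n}. degree ([:\<theta> j, -1:]\<^sup>2 + [:\<theta> j:]))"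
      using degree_prod_sum_le[of "{1..n}" "\<lambda>j. [:\<theta> j, -1:]\<^sup>2 + [:\<theta> j:]"] by (simp add: o_def)
    also have "\<dots> \<le> (\<Sum>j\<in>{1..n}. 2)"
      by (rule sum_mono) (simp add: power2_eq_square)
    \<comment> \<open>The bound \<open>2 * n\<close> is below \<open>3 * n\<close> because
      \<open>n\<close> is positive.\<close>
    also have "\<dots> \<le> 3 * n - 1" using assms(1) by simp
    finally have degP: "degree ?P \<le> 3 * n - 1" .
    have degF: "degree (?F i) \<le> 3 * n - 1" if i: "i \<in> {1..n}" for i
    proof -
      have "degree (\<Prod>j\<in>{1..n}-{i}. [:\<theta> j, -1:] ^ 3)
          \<le> (\<Sum>j\<in>{1..n}-{i}. degree ([:\<theta> j, -1:] ^ 3))"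
        using degree_prod_sum_le[of "{1..n}-{i}" "\<lambda>j. [:\<theta> j, -1:] ^ 3"] by (simp add: o_def)
      also have "\<dots> \<le> (\<Sum>j\<in>{1..n}-{i}. 3)"
        by (rule sum_mono) (simp add: degree_power_eq)
      also have "\<dots> = 3 * (n - 1)" using i by simp
      finally have "degree (\<Prod>j\<in>{1..n}-{i}. [:\<theta> j, -1:] ^ 3) \<le> 3 * (n - 1)" .
      moreover have "degree (hypoXG_numerator n \<theta> i) \<le> 2"
        unfolding hypoXG_numerator_def power2_eq_square by (simp add: numeral_eq_Suc)
      ultimately show ?thesis
        using degree_mult_le[of "hypoXG_numerator n \<theta> i" "\<Prod>j\<in>{1..n}-{i}. [:\<theta> j, -1:] ^ 3"]
          assms(1) by simp
    qed
    have "degree (?P - (\<Sum>i\<in>{1..n}. ?F i)) \<le> 3 * n - 1"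
      by (intro degree_diff_le degP degree_sum_le degF) auto
    then show "degree (?P - (\<Sum>i\<in>{1..n}. ?F i)) < 3 * card (\<theta> ` {1..n})"
      using assms(1) inj by (simp add: card_image)
  next
    fix r assume "r \<in> \<theta> ` {1..n}"
    then obtain i where i: "i \<in> {1..n}" "r = \<theta> i" by auto
    have "[:\<theta> i, -1:] ^ 3 dvd ?P - ?F i"
      using hypoXG_numerator_cong[OF pos inj i(1)] by (simp only: cong_iff_dvd_diff)
    \<comment> \<open>Every summand with \<open>k\<close> different from \<open>i\<close> retains
      the cube belonging to \<open>i\<close>, so only \<open>?F i\<close> matters modulo that
      cube.\<close>
    moreover have "[:\<theta> i, -1:] ^ 3 dvd (\<Sum>k\<in>{1..n}-{i}. ?F k)"
    proof (rule dvd_sum)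
      fix k assume "k \<in> {1..n} - {i}"
      then have "i \<in> {1..n} - {k}" using i by auto
      then show "[:\<theta> i, -1:] ^ 3 dvd ?F k"
        by (intro dvd_mult dvd_prodI) simp_all
    qed
    ultimately have "[:\<theta> i, -1:] ^ 3 dvd ?P - ?F i - (\<Sum>k\<in>{1..n}-{i}. ?F k)"
      by (rule dvd_diff)
    also have "?P - ?F i - (\<Sum>k\<in>{1..n}-{i}. ?F k) = ?P - (\<Sum>k\<in>{1..n}. ?F k)"
      using sum.remove[of "{1..n}" i ?F] i(1) by simp
    \<comment> \<open>The factors are \<open>\<theta> i - X\<close>, whereas root multiplicity is
      phrased with \<open>X - r\<close>; the odd power costs only a sign.\<close>
    also have "[:\<theta> i, -1:] ^ 3 = - ([:-r, 1:] ^ 3)"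
      using i(2) power_minus_odd[of 3 "[:-r, 1:]"] by simp
    finally show "[:-r, 1:] ^ 3 dvd ?P - (\<Sum>k\<in>{1..n}. ?F k)"
      by (simp only: minus_dvd_iff)
  qed
  then show ?thesis by simp
qed

text \<open>The polynomial identity is evaluated at \<open>t\<close> and divided by the product of
  all cubes, which is nonzero away from the poles.\<close>

lemma hypoXG_partial_fractions:
  assumes "n \<ge> 1" and pos: "\<And>i. i \<in> {1..n} \<Longrightarrow> \<theta> i > 0" and inj: "inj_on \<theta> {1..n}"
    and t: "\<And>i. i \<in> {1..n} \<Longrightarrow> \<theta> i \<noteq> t"
  shows "(\<Prod>j=1..n. ((\<theta> j - t)\<^sup>2 + \<theta> j) / (\<theta> j - t) ^ 3)
    = (\<Sum>i=1..n. \<Sum>k=1..3. hypoXG_A n \<theta> i k / (\<theta> i - t) ^ (4 - k))"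
proof -
  let ?Q = "\<lambda>j. (\<theta> j - t) ^ 3"
  have nz: "(\<Prod>j\<in>J. ?Q j) \<noteq> 0" if "J \<subseteq> {1..n}" for J
  proof -
    have "\<forall>j\<in>J. \<theta> j \<noteq> t" using that t by blast
    then show ?thesis using finite_subset[OF that] by (subst prod_zero_iff) auto
  qed
  have "(\<Prod>j=1..n. (\<theta> j - t)\<^sup>2 + \<theta> j)
      = (\<Sum>i=1..n. poly (hypoXG_numerator n \<theta> i) t * (\<Prod>j\<in>{1..n}-{i}. ?Q j))"
    using arg_cong[OF hypoXG_numerator_identity[OF assms(1) pos inj], of "\<lambda>p. poly p t"]
    by (simp add: poly_prod poly_sum)
  then have "(\<Prod>j=1..n. ((\<theta> j - t)\<^sup>2 + \<theta> j) / ?Q j)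
      = (\<Sum>i=1..n. poly (hypoXG_numerator n \<theta> i) t * (\<Prod>j\<in>{1..n}-{i}. ?Q j) / (\<Prod>j=1..n. ?Q j))"
    by (simp add: prod_dividef sum_divide_distrib)
  also have "\<dots> = (\<Sum>i=1..n. \<Sum>k=1..3. hypoXG_A n \<theta> i k / (\<theta> i - t) ^ (4 - k))"
  proof (rule sum.cong[OF refl])
    fix i assume i: "i \<in> {1..n}"
    have "(\<Prod>j=1..n. ?Q j) = ?Q i * (\<Prod>j\<in>{1..n}-{i}. ?Q j)"
      by (rule prod.remove) (use i in auto)
    then have "poly (hypoXG_numerator n \<theta> i) t * (\<Prod>j\<in>{1..n}-{i}. ?Q j) / (\<Prod>j=1..n. ?Q j)
        = poly (hypoXG_numerator n \<theta> i) t / ?Q i"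
      using nz[of "{1..n}-{i}"] by simp
    also have "\<dots> = (\<Sum>k=1..3. hypoXG_A n \<theta> i k / (\<theta> i - t) ^ (4 - k))"
    proof -
      define u where "u = \<theta> i - t"
      have "u \<noteq> 0" using t[OF i] by (simp add: u_def)
      moreover have "poly (hypoXG_numerator n \<theta> i) t
          = hypoXG_A1 n \<theta> i + hypoXG_A2 n \<theta> i * u + hypoXG_A3 n \<theta> i * u\<^sup>2"
        by (simp add: hypoXG_numerator_def u_def power2_eq_square algebra_simps)
      moreover have "{1..3::nat} = {1, 2, 3}" by auto
      ultimately show ?thesis
        unfolding u_def[symmetric]
        by (simp add: hypoXG_A_def add_divide_distrib power2_eq_square power3_eq_cube)
    qed
    finally show "poly (hypoXG_numerator n \<theta> i) t * (\<Prod>j\<in>{1..n}-{i}. ?Q j) / (\<Prod>j=1..n. ?Q j)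
        = (\<Sum>k=1..3. hypoXG_A n \<theta> i k / (\<theta> i - t) ^ (4 - k))" .
  qed
  finally show ?thesis .
qed

section \<open>The Erlang expansion of the moment generating function\<close>

theorem theorem2p4:
  fixes M :: "'a measure" and S :: "'a \<Rightarrow> real"
    and N :: "nat \<Rightarrow> nat \<Rightarrow> 'b measure" and Y :: "nat \<Rightarrow> nat \<Rightarrow> 'b \<Rightarrow> real"
    and \<theta> :: "nat \<Rightarrow> real" and n :: nat and t :: real
  assumes "n \<ge> 1"
    and "\<And>i. i \<in> {1..n} \<Longrightarrow> \<theta> i > 0"
    and "inj_on \<theta> {1..n}"
    and "prob_space M"
    and "hypoXG M S n \<theta>"
    and "\<And>i k. i \<in> {1..n} \<Longrightarrow> k \<in> {1..3} \<Longrightarrow> prob_space (N i k)"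
    and "\<And>i k. i \<in> {1..n} \<Longrightarrow> k \<in> {1..3} \<Longrightarrow> erlang_distributed (N i k) (Y i k) (4 - k) (\<theta> i)"
    and "t < Min (\<theta> ` {1..n})"
  shows "integrable M (\<lambda>\<omega>. exp (t * S \<omega>))
       \<and> mgf M S t = (\<Sum>i=1..n. \<Sum>k=1..3. hypoXG_R n \<theta> i k * mgf (N i k) (Y i k) t)
       \<and> (\<forall>i\<in>{1..n}. \<forall>k\<in>{1..3}.
            integrable (N i k) (\<lambda>\<omega>. exp (t * Y i k \<omega>))
          \<and> mgf (N i k) (Y i k) t = \<theta> i ^ (4 - k) / (\<theta> i - t) ^ (4 - k))"

proof -
  have less: "t < \<theta> i" if "i \<in> {1..n}" for i
    using assms(8) that by simp
  have Y: "integrable (N i k) (\<lambda>\<omega>. exp (t * Y i k \<omega>))"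
    "mgf (N i k) (Y i k) t = \<theta> i ^ (4 - k) / (\<theta> i - t) ^ (4 - k)"
    if i: "i \<in> {1..n}" and k: "k \<in> {1..3}" for i k
  proof -
    have "distributed (N i k) lborel (Y i k) (erlang_density (3 - k) (\<theta> i))"
      using assms(7)[OF i k] by (simp add: erlang_distributed_def)
    note Y = distributed_mgf[OF this _ has_bochner_integral_erlang_mgf[OF assms(2)[OF i] less[OF i]]]
    show "integrable (N i k) (\<lambda>\<omega>. exp (t * Y i k \<omega>))"
      using Y(1) assms(2)[OF i] by simp
    \<comment> \<open>The density index is the shape \<open>4 - k\<close> minus one, and the moment
      formula adds the one back. Truncated subtraction makes \<open>k \<le> 3\<close>
      essential.\<close>
    have "Suc (3 - k) = 4 - k" using k by auto
    then show "mgf (N i k) (Y i k) t = \<theta> i ^ (4 - k) / (\<theta> i - t) ^ (4 - k)"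
      using Y(2) assms(2)[OF i] by (simp add: power_divide del: power_Suc)
  qed
  let ?c = "\<Prod>l=1..n. (\<theta> l)\<^sup>2 / (1 + \<theta> l)"
  have "mgf M S t = ?c * (\<Prod>j=1..n. ((\<theta> j - t)\<^sup>2 + \<theta> j) / (\<theta> j - t) ^ 3)"
    using hypoXG_mgf(2)[OF assms(4,5,2) less] by (simp only: prod.distrib)
  also have "\<dots> = ?c * (\<Sum>i=1..n. \<Sum>k=1..3. hypoXG_A n \<theta> i k / (\<theta> i - t) ^ (4 - k))"
    by (subst hypoXG_partial_fractions[OF assms(1,2,3)]) (use less in force)+
  also have "\<dots> = (\<Sum>i=1..n. \<Sum>k=1..3. hypoXG_R n \<theta> i k * mgf (N i k) (Y i k) t)"
    unfolding sum_distrib_left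
  proof (intro sum.cong refl)
    fix i k assume i: "i \<in> {1..n}" and k: "k \<in> {1..3::nat}"
    \<comment> \<open>The divisor \<open>\<theta> i ^ (4 - k)\<close> in \<open>hypoXG_R\<close>
      cancels the numerator of the Erlang moment generating function.\<close>
    show "?c * (hypoXG_A n \<theta> i k / (\<theta> i - t) ^ (4 - k)) = hypoXG_R n \<theta> i k * mgf (N i k) (Y i k) t"
      using assms(2)[OF i] unfolding Y(2)[OF i k] hypoXG_R_def by simp
  qed
  finally show ?thesis
    using hypoXG_mgf(1)[OF assms(4,5,2) less] Y by blast
qed

end
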